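(* For every integer $n\geq 2$, the Bernoulli-Fibonacci polynomials and numbers satisfy $$B_n^F(1) = b_n^F.$$
   Context: Let $F_n$ be the Fibonacci numbers ($F_0=0$, $F_1=F_2=1$, $F_{n+1}=F_n+F_{n-1}$). The Fibonacci factorial is $F_n! = F_1F_2\cdots F_n$ for $n\ge 1$, with $F_0! = 1$. The Golden exponential function is $e_F^x = \sum_{n=0}^\infty \frac{x^n}{F_n!}$ (written $e_F^{zx}$ when evaluated at $zx$). The Bernoulli-Fibonacci polynomials $B_n^F(x)$, $n\geq 0$, are defined by the generating function (power series in $z$) $$\frac{z\, e_F^{zx}}{e_F^{z}-1} = \sum_{n=0}^\infty B_n^F(x)\frac{z^n}{F_n!}.$$ The Bernoulli-Fibonacci numbers are $b_n^F = B_n^F(0)$; equivalently $\frac{z}{e_F^z-1} = \sum_{n=0}^\infty b_n^F \frac{z^n}{F_n!}$. *)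

theory Defs
  imports
    "HOL-Number_Theory.Fib"
    "HOL-Computational_Algebra.Formal_Power_Series"
    "HOL-Computational_Algebra.Polynomial"
begin

definition fib_fact :: "nat \<Rightarrow> nat" where
  "fib_fact n = (\<Prod>k=1..n. fib k)"

text \<open>\<open>golden_exp x\<close> is the power series of \<open>e\<^sub>F\<^sup>z\<^sup>x\<close> in the formal variable \<open>z\<close>.\<close>

definition golden_exp :: "'a::field_char_0 \<Rightarrow> 'a fps" where
  "golden_exp x = Abs_fps (\<lambda>n. x ^ n / of_nat (fib_fact n))"

text \<open>
  The denominator of the generating function vanishes to order exactly one at \<open>z = 0\<close>,
  and the numerator is a multiple of \<open>z\<close>, so the division of formal power series below
  is exact (see \<open>bernoulli_fib_generating_function\<close>).
  The polynomials are represented by their values at \<open>x\<close>; that these are indeed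
  polynomial in \<open>x\<close> is \<open>bernoulli_fib_is_poly\<close>.
\<close>

definition bernoulli_fib :: "nat \<Rightarrow> 'a::field_char_0 \<Rightarrow> 'a" where
  "bernoulli_fib n x =
     of_nat (fib_fact n) * fps_nth (fps_X * golden_exp x / (golden_exp 1 - 1)) n"

definition bernoulli_fib_num :: "nat \<Rightarrow> 'a::field_char_0" where
  "bernoulli_fib_num n = bernoulli_fib n 0"

lemma fib_fact_nonzero: "fib_fact n \<noteq> 0"
  by (auto simp: fib_fact_def intro: fib_neq_0_nat)

lemma golden_exp_denominator:
  "(golden_exp 1 - 1 :: 'a::field_char_0 fps) \<noteq> 0"
  "subdegree (golden_exp 1 - 1 :: 'a::field_char_0 fps) = 1"
proof -
  have *: "fps_nth (golden_exp 1 - 1 :: 'a fps) 1 = 1"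
    "fps_nth (golden_exp 1 - 1 :: 'a fps) 0 = 0"
    by (simp_all add: golden_exp_def fib_fact_def)
  show "(golden_exp 1 - 1 :: 'a fps) \<noteq> 0"
    using *(1) by (metis fps_zero_nth zero_neq_one)
  show "subdegree (golden_exp 1 - 1 :: 'a fps) = 1"
    by (rule subdegreeI) (use * in auto)
qed

lemma golden_exp_denominator_dvd:
  "(golden_exp 1 - 1 :: 'a::field_char_0 fps) dvd fps_X * f"
proof (cases "f = 0")
  case False
  then have "fps_X * f \<noteq> 0" "subdegree (fps_X * f) \<ge> 1" by simp_all
  then show ?thesis
    by (simp only: fps_dvd_iff golden_exp_denominator not_False_eq_True)
qed simp

lemma bernoulli_fib_generating_function:
  "Abs_fps (\<lambda>n. bernoulli_fib n x / of_nat (fib_fact n)) * (golden_exp 1 - 1) =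
     fps_X * golden_exp (x :: 'a::field_char_0)"
proof -
  have "Abs_fps (\<lambda>n. bernoulli_fib n x / of_nat (fib_fact n)) =
      fps_X * golden_exp x / (golden_exp 1 - 1)"
    by (simp add: fps_eq_iff bernoulli_fib_def fib_fact_nonzero)
  then show ?thesis
    using golden_exp_denominator_dvd[of "golden_exp x"] by (simp only: dvd_div_mult_self)
qed

lemma bernoulli_fib_is_poly:
  "\<exists>p. \<forall>x::'a::field_char_0. bernoulli_fib n x = poly p x"
proof -
  define g where "g = (fps_X :: 'a fps) / (golden_exp 1 - 1)"
  have g: "fps_X * golden_exp x / (golden_exp 1 - 1) = g * golden_exp x" for x :: 'a
  proof -
    have "(golden_exp 1 - 1 :: 'a fps) dvd fps_X"
      using golden_exp_denominator_dvd[of 1] by simp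
    then show ?thesis by (simp add: g_def dvd_div_mult)
  qed
  define p where "p = (\<Sum>i=0..n. monom
     (of_nat (fib_fact n) * fps_nth g i / of_nat (fib_fact (n - i))) (n - i))"
  have "bernoulli_fib n x = poly p x" for x
    unfolding bernoulli_fib_def g
    by (simp add: p_def fps_mult_nth poly_sum poly_monom golden_exp_def
        sum_distrib_left mult.assoc)
  then show ?thesis by blast
qed

end

theory Submission
  imports Defs
begin

text \<open>
  The generating functions at \<open>x = 1\<close> and \<open>x = 0\<close> have the common denominator
  \<open>e\<^sub>F\<^sup>z - 1\<close>, and their numerators \<open>z e\<^sub>F\<^sup>z\<close> and \<open>z\<close> differ by \<open>z\<close> times that
  denominator. Hence the two series differ by exactly \<open>z\<close>, so only the
  coefficients of index \<open>1\<close> can disagree.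
\<close>

lemma golden_exp_0: "golden_exp (0 :: 'a::field_char_0) = 1"
  by (simp add: golden_exp_def fib_fact_def fps_eq_iff)

lemma generating_function_1_eq_X_plus_0:
  "fps_X * golden_exp 1 / (golden_exp 1 - 1) =
     fps_X + fps_X * golden_exp 0 / (golden_exp 1 - 1 :: 'a::field_char_0 fps)"
proof -
  let ?D = "golden_exp 1 - 1 :: 'a fps"
  have "fps_X * golden_exp 1 = ?D * fps_X + fps_X * golden_exp 0"
    by (simp add: golden_exp_0 algebra_simps)
  then show ?thesis
    by (simp only: div_mult_self4[OF golden_exp_denominator(1)])
qed

theorem proposition4p0p10:
  fixes n :: nat
  assumes "n \<ge> 2"
  shows "bernoulli_fib n (1 :: 'a::field_char_0) = bernoulli_fib_num n"
  using assms
  by (simp add: bernoulli_fib_def bernoulli_fib_num_def generating_function_1_eq_X_plus_0)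

end
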